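(* Let $L$ be a Noether lattice. Let $0\neq p\in L$ be a non-nilpotent proper element satisfying the restricted cancellation law. Let $b\in L$ be such that $p<b$. Then $b$ is $\phi$-$\delta$-primary to $p$ for some function $\phi:L\to L$ with $\phi\leqslant\phi_2$ if and only if $b$ is $\delta$-primary to $p$.
   Context: A multiplicative lattice is a complete lattice (least element $0$, largest element $1$) with a commutative, associative multiplication that distributes over arbitrary joins and has $1$ as multiplicative identity. An element $a$ is compact if whenever $a\leqslant \vee X$ for $X\subseteq L$ there are finitely many $a_1,\dots,a_n\in X$ with $a\leqslant a_1\vee\cdots\vee a_n$. Standing assumptions: $L$ is a compactly generated multiplicative lattice (every element is a join of compact elements), $1$ is compact, and every finite product of compact elements is compact. For $a,b\in L$, $(a:b)=\vee\{x\in L\mid xb\leqslant a\}$. An element $e$ is principal if it is meet principal ($a\wedge be=((a:e)\wedge b)e$ for all $a,b$) and join principal ($(ae\vee b):e=(b:e)\vee a$ for all $a,b$). A Noether lattice is a multiplicative lattice that is modular, principally generated (every element is a join of principal elements) and satisfies the ascending chain condition. An element $a$ satisfies the restricted cancellation law if for all $b,c\in L$, $ab=ac\neq 0$ implies $b=c$. An element $p$ is proper if $p<1$, and non-nilpotent if $p^n\neq 0$ for all positive integers $n$. $\delta:L\to L$ is an expansion function: $a\leqslant\delta(a)$ for all $a$, and $a\leqslant b$ implies $\delta(a)\leqslant\delta(b)$. An element $b$ is $\delta$-primary to a proper element $p$ if for all $x\in L$, $xb\leqslant p$ implies $x\leqslant\delta(p)$. For $\phi:L\to L$, $b$ is $\phi$-$\delta$-primary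 to a proper element $p$ if for all $x\in L$, $xb\leqslant p$ and $xb\not\leqslant\phi(p)$ implies $x\leqslant\delta(p)$. $\phi_2(q)=q^2$. For functions $\gamma_1,\gamma_2:L\to L$, $\gamma_1\leqslant\gamma_2$ means $\gamma_1(a)\leqslant\gamma_2(a)$ for every $a\in L$. *)

theory Defs
  imports Main
begin

unbundle lattice_syntax

text \<open>The least and the largest element are the lattice constants \<open>\<bottom>\<close> and \<open>\<top>\<close>;
  the latter is identified with the multiplicative unit \<open>1\<close>. The case \<open>X = {}\<close> of
  distributivity says that \<open>a * \<bottom> = \<bottom>\<close>.\<close>

class multiplicative_lattice = complete_lattice + comm_monoid_mult +
  assumes one_eq_top: "1 = \<top>"
    and mult_Sup: "a * \<Squnion>X = \<Squnion>((\<lambda>x. a * x) ` X)"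
begin

definition compact_elem :: "'a \<Rightarrow> bool" where
  "compact_elem a \<longleftrightarrow> (\<forall>X. a \<le> \<Squnion>X \<longrightarrow> (\<exists>F. finite F \<and> F \<subseteq> X \<and> a \<le> \<Squnion>F))"

definition residual :: "'a \<Rightarrow> 'a \<Rightarrow> 'a" where
  "residual a b = \<Squnion>{x. x * b \<le> a}"

definition meet_principal :: "'a \<Rightarrow> bool" where
  "meet_principal e \<longleftrightarrow> (\<forall>a b. a \<sqinter> (b * e) = (residual a e \<sqinter> b) * e)"

definition join_principal :: "'a \<Rightarrow> bool" where
  "join_principal e \<longleftrightarrow> (\<forall>a b. residual (a * e \<squnion> b) e = residual b e \<squnion> a)"

definition principal :: "'a \<Rightarrow> bool" where
  "principal e \<longleftrightarrow> meet_principal e \<and> join_principal e"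

definition proper :: "'a \<Rightarrow> bool" where
  "proper p \<longleftrightarrow> p < 1"

definition non_nilpotent :: "'a \<Rightarrow> bool" where
  "non_nilpotent p \<longleftrightarrow> (\<forall>n>0. p ^ n \<noteq> \<bottom>)"

definition restricted_cancellation :: "'a \<Rightarrow> bool" where
  "restricted_cancellation a \<longleftrightarrow> (\<forall>b c. a * b = a * c \<and> a * c \<noteq> \<bottom> \<longrightarrow> b = c)"

definition expansion_function :: "('a \<Rightarrow> 'a) \<Rightarrow> bool" where
  "expansion_function \<delta> \<longleftrightarrow> (\<forall>a. a \<le> \<delta> a) \<and> (\<forall>a b. a \<le> b \<longrightarrow> \<delta> a \<le> \<delta> b)"

definition delta_primary_to :: "('a \<Rightarrow> 'a) \<Rightarrow> 'a \<Rightarrow> 'a \<Rightarrow> bool" where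
  "delta_primary_to \<delta> b p \<longleftrightarrow> proper p \<and> (\<forall>x. x * b \<le> p \<longrightarrow> x \<le> \<delta> p)"

definition phi_delta_primary_to :: "('a \<Rightarrow> 'a) \<Rightarrow> ('a \<Rightarrow> 'a) \<Rightarrow> 'a \<Rightarrow> 'a \<Rightarrow> bool" where
  "phi_delta_primary_to \<phi> \<delta> b p \<longleftrightarrow>
     proper p \<and> (\<forall>x. x * b \<le> p \<and> \<not> x * b \<le> \<phi> p \<longrightarrow> x \<le> \<delta> p)"

definition phi2 :: "'a \<Rightarrow> 'a" where
  "phi2 q = q ^ 2"

end

class compactly_generated_multiplicative_lattice = multiplicative_lattice +
  assumes compactly_generated: "\<exists>X. (\<forall>x\<in>X. compact_elem x) \<and> a = \<Squnion>X"
    and compact_one: "compact_elem 1"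
    and compact_prod_list: "(\<forall>x\<in>set xs. compact_elem x) \<Longrightarrow> compact_elem (prod_list xs)"

class noether_lattice = compactly_generated_multiplicative_lattice +
  assumes modular: "a \<le> c \<Longrightarrow> a \<squnion> (b \<sqinter> c) = (a \<squnion> b) \<sqinter> c"
    and principally_generated: "\<exists>X. (\<forall>x\<in>X. principal x) \<and> a = \<Squnion>X"
    and ascending_chain_condition:
      "(\<And>n. f n \<le> f (Suc n)) \<Longrightarrow> \<exists>N. \<forall>n\<ge>N. f n = f N"

end

(* If x b \<le> p but x b \<le> \<phi> p \<le> p\<^sup>2, replace x by x \<squnion> p: still (x \<squnion> p) b \<le> p, and (x \<squnion> p) b \<le> p\<^sup>2
   would give p b = p\<^sup>2 \<noteq> \<bottom>, hence b = p by restricted cancellation. *)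
theory Submission
  imports Defs
begin

lemma mult_sup_distrib:
  fixes a b c :: "'a :: multiplicative_lattice"
  shows "a * (b \<squnion> c) = a * b \<squnion> a * c"
  using mult_Sup[of a "{b, c}"] by simp

lemma mult_le_mono:
  fixes a b c :: "'a :: multiplicative_lattice"
  assumes "b \<le> c"
  shows "a * b \<le> a * c"
proof -
  have "a * b \<squnion> a * c = a * c"
    using mult_sup_distrib[of a b c] assms by (simp add: sup_absorb2)
  then show ?thesis
    by (metis sup_ge1)
qed

lemma mult_le_left:
  fixes a b :: "'a :: multiplicative_lattice"
  shows "a * b \<le> a"
proof -
  have "b \<le> 1"
    by (simp add: one_eq_top)
  from mult_le_mono[OF this, of a] show ?thesis
    by simp
qed

text \<open>Since \<open>p < b\<close>, monotonicity already gives \<open>p * p \<le> p * b\<close>.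
  The opposite bound would therefore yield an equality of two nonzero multiples of \<open>p\<close>,
  which is the case where the restricted law allows cancelling.\<close>

lemma restricted_cancellation_not_mult_le_square:
  fixes p b :: "'a :: multiplicative_lattice"
  assumes "restricted_cancellation p" and "p ^ 2 \<noteq> \<bottom>" and "p < b"
  shows "\<not> p * b \<le> p ^ 2"
proof
  assume "p * b \<le> p ^ 2"
  moreover have "p ^ 2 \<le> p * b"
    using mult_le_mono[of p b p] assms(3) by (simp add: power2_eq_square)
  ultimately have "p * b = p * p"
    by (simp add: power2_eq_square)
  moreover have "p * p \<noteq> \<bottom>"
    using assms(2) by (simp add: power2_eq_square)
  ultimately have "b = p"
    using assms(1) unfolding restricted_cancellation_def by blast
  then show False
    using assms(3) by simp
qed

theorem theorem2p17:
  fixes p b :: "'a :: noether_lattice" and \<delta> :: "'a \<Rightarrow> 'a"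
  assumes "expansion_function \<delta>"
    and "p \<noteq> \<bottom>"
    and "non_nilpotent p"
    and "proper p"
    and "restricted_cancellation p"
    and "p < b"
  shows "(\<exists>\<phi>. \<phi> \<le> phi2 \<and> phi_delta_primary_to \<phi> \<delta> b p) \<longleftrightarrow> delta_primary_to \<delta> b p"
proof
  assume "\<exists>\<phi>. \<phi> \<le> phi2 \<and> phi_delta_primary_to \<phi> \<delta> b p"
  then obtain \<phi> where \<phi>: "\<phi> \<le> phi2" and prim: "phi_delta_primary_to \<phi> \<delta> b p"
    by blast
  have "\<phi> p \<le> p ^ 2"
    using \<phi> by (simp add: le_fun_def phi2_def)
  \<comment> \<open>Non-nilpotency enters at exponent 2: it supplies
    \<open>p ^ 2 \<noteq> \<bottom>\<close>.\<close>
  moreover have "\<not> p * b \<le> p ^ 2"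
    using assms(3,5,6)
    by (intro restricted_cancellation_not_mult_le_square) (auto simp: non_nilpotent_def)
  ultimately have not_le: "\<not> p * b \<le> \<phi> p"
    by (meson order_trans)
  \<comment> \<open>No case split on whether \<open>x * b \<le> \<phi> p\<close>: passing to
    \<open>x \<squnion> p\<close> works for every such \<open>x\<close>.\<close>
  have "x \<le> \<delta> p" if "x * b \<le> p" for x
  proof -
    have eq: "(x \<squnion> p) * b = x * b \<squnion> p * b"
      using mult_sup_distrib[of b x p] by (simp add: mult.commute)
    have "(x \<squnion> p) * b \<le> p"
      using that mult_le_left[of p b] by (simp add: eq)
    \<comment> \<open>A join lies below \<open>\<phi> p\<close> only if both joinands do, and
      \<open>p * b\<close> does not.\<close>
    moreover have "\<not> (x \<squnion> p) * b \<le> \<phi> p"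
      using not_le by (simp add: eq)
    ultimately have "x \<squnion> p \<le> \<delta> p"
      using prim unfolding phi_delta_primary_to_def by blast
    then show ?thesis
      by simp
  qed
  then show "delta_primary_to \<delta> b p"
    using assms(4) by (simp add: delta_primary_to_def)
next
  assume "delta_primary_to \<delta> b p"
  \<comment> \<open>Any \<phi> would do here, as it merely adds a premise to the implication;
    \<open>phi2\<close> meets the bound by reflexivity.\<close>
  then have "phi_delta_primary_to phi2 \<delta> b p"
    by (simp add: delta_primary_to_def phi_delta_primary_to_def)
  then show "\<exists>\<phi>. \<phi> \<le> phi2 \<and> phi_delta_primary_to \<phi> \<delta> b p"
    by blast
qed

end
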